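(* Let $K$ be a complete ultrametric field, let $\lambda\in K$ with $|\lambda|>1$, let $\rho>0$ be a real number, and let $f\in\mathcal{F}_{\lambda,\rho}(K)$, i.e. $f(x)=\lambda x+\sum_{i=2}^{\infty}a_i x^i\in K[[x]]$ with $1/\sup_{i\geq 2}|a_i|^{1/(i-1)}=\rho$. Put $$\gamma=\inf_{i\geq 2}\left(|\lambda|/|a_i|\right)^{1/(i-1)},\qquad R_f=1/\limsup_{i\to\infty}|a_i|^{1/i},\qquad \delta_f=\min\{R_f,\gamma\}.$$ Then there is a unique function $g$, with $g(0)=0$ and $g'(0)=1$, convergent and injective on the open disc $\{x\in K: |x|<|\lambda|\gamma\}$, such that both the semi-conjugacy $$g\circ f(x)=\lambda g(x)$$ and the full conjugacy $$g\circ f\circ g^{-1}(x)=\lambda x$$ hold for $|x|<\delta_f$.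
   Context: $K$ is a field complete with respect to an ultrametric (non-Archimedean) absolute value $|\cdot|$; it may have any characteristic and its residue field may have any characteristic. For $\lambda\in K$, $\lambda\ne 0$, and a real number $\rho>0$, $$\mathcal{F}_{\lambda,\rho}(K)=\Big\{f\in K[[x]]: f(x)=\lambda x+\sum_{i=2}^{\infty}a_i x^i,\ 1/\sup_{i\ge 2}|a_i|^{1/(i-1)}=\rho\Big\}.$$ Conventions: $|\lambda|/0=\infty$ and $1/0=\infty$. $R_f$ is the radius of convergence of $f$ and $\delta_f=\min\{R_f,\inf_{i\ge2}(|\lambda|/|a_i|)^{1/(i-1)}\}$ is called the radius of injectivity of $f$. Functions on discs about the origin here are those given by convergent power series over $K$ centred at $0$ ("convergent on a disc" means that the power series converges there), and $f$ is regarded as the function defined by its power series. $g^{-1}$ denotes the local inverse of $g$ fixing the origin (the compositional inverse power series). To say that the full conjugacy holds for $|x|<r$ means that for all $x\in K$ with $|x|<r$ the left-hand side $g(f(g^{-1}(x)))$ is defined and equals $\lambda x$. *)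

theory Defs
  imports Complex_Main "HOL-Library.Extended_Real" "HOL-Library.Liminf_Limsup"
    "HOL-Computational_Algebra.Formal_Power_Series"
begin

text \<open>
  Fields with an ultrametric absolute value \<open>absval\<close>, which induces the metric and hence the
  topology. No condition is put on the characteristic or on the residue field. The library's
  \<open>norm\<close> is not used because it is reserved for real vector spaces.
\<close>

class ultrametric_field = field + metric_space +
  fixes absval :: "'a \<Rightarrow> real"
  assumes dist_absval: "dist x y = absval (x - y)"
    and absval_mult: "absval (x * y) = absval x * absval y"
    and absval_add: "absval (x + y) \<le> max (absval x) (absval y)"
begin

lemma absval_nonneg: "0 \<le> absval x"
  using dist_absval[of x 0] zero_le_dist[of x 0] by simp

lemma absval_eq_0_iff: "absval x = 0 \<longleftrightarrow> x = 0"
  by (metis dist_absval dist_eq_0_iff diff_zero)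

end

class complete_ultrametric_field = ultrametric_field + complete_space

text \<open>
  The library's \<open>eval_fps\<close> and \<open>fps_conv_radius\<close> are restricted to normed algebras over the reals,
  hence the following counterparts.
\<close>

definition converges_at :: "'a::ultrametric_field fps \<Rightarrow> 'a \<Rightarrow> bool" where
  "converges_at f x \<longleftrightarrow> summable (\<lambda>n. fps_nth f n * x ^ n)"

definition value_at :: "'a::ultrametric_field fps \<Rightarrow> 'a \<Rightarrow> 'a" where
  "value_at f x = (\<Sum>n. fps_nth f n * x ^ n)"

definition convergence_radius :: "'a::ultrametric_field fps \<Rightarrow> ereal" where
  "convergence_radius f = 1 / limsup (\<lambda>i. ereal (absval (fps_nth f i) powr (1 / real i)))"

text \<open>The family \<open>\<F>\<close> of the paper; in \<^typ>\<open>ereal\<close> one has \<open>1 / 0 = \<infinity>\<close> and \<open>1 / \<infinity> = 0\<close>.\<close>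

definition series_family :: "'a::ultrametric_field \<Rightarrow> real \<Rightarrow> 'a fps set" where
  "series_family lam \<rho> =
    {f. fps_nth f 0 = 0 \<and> fps_nth f 1 = lam \<and>
        1 / (SUP i\<in>{2..}. ereal (absval (fps_nth f i) powr (1 / (real i - 1)))) = ereal \<rho>}"

text \<open>
  The number \<open>\<gamma>\<close>, with \<open>\<lambda>\<close> read off as the linear coefficient. The case distinction is the
  convention \<open>\<bar>\<lambda>\<bar> / 0 = \<infinity>\<close>; real division would give \<open>0\<close>.
\<close>

definition gamma_radius :: "'a::ultrametric_field fps \<Rightarrow> ereal" where
  "gamma_radius f =
    (INF i\<in>{2..}. if fps_nth f i = 0 then \<infinity>
       else ereal ((absval (fps_nth f 1) / absval (fps_nth f i)) powr (1 / (real i - 1))))"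

definition injectivity_radius :: "'a::ultrametric_field fps \<Rightarrow> ereal" where
  "injectivity_radius f = min (convergence_radius f) (gamma_radius f)"

definition open_disc :: "ereal \<Rightarrow> 'a::ultrametric_field set" where
  "open_disc r = {x. ereal (absval x) < r}"

text \<open>
  The two conjugacies include the assertion that every series involved converges at the point where
  it is evaluated. In the second one \<^term>\<open>fps_inv g\<close> is the compositional inverse.
\<close>

definition semi_conjugacy_on ::
  "'a::ultrametric_field set \<Rightarrow> 'a \<Rightarrow> 'a fps \<Rightarrow> 'a fps \<Rightarrow> bool" where
  "semi_conjugacy_on D lam f g \<longleftrightarrow>
    (\<forall>x\<in>D. converges_at f x \<and> converges_at g (value_at f x) \<and> converges_at g x \<and>
       value_at g (value_at f x) = lam * value_at g x)"

definition full_conjugacy_on ::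
  "'a::ultrametric_field set \<Rightarrow> 'a \<Rightarrow> 'a fps \<Rightarrow> 'a fps \<Rightarrow> bool" where
  "full_conjugacy_on D lam f g \<longleftrightarrow>
    (\<forall>x\<in>D. converges_at (fps_inv g) x \<and>
       converges_at f (value_at (fps_inv g) x) \<and>
       converges_at g (value_at f (value_at (fps_inv g) x)) \<and>
       value_at g (value_at f (value_at (fps_inv g) x)) = lam * x)"

end

theory Submission imports Defs begin

text \<open>
  Write \<open>s = \<bar>\<lambda>\<bar> * \<gamma>\<close>. By definition \<open>\<gamma>\<close> is the largest radius at which the coefficients of
  \<open>f\<close> satisfy \<open>\<bar>a\<^sub>i\<bar> * \<gamma>\<^sup>i \<le> \<bar>\<lambda>\<bar> * \<gamma>\<close>, that is, at which the linear term is maximal; in other words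
  the Gauss norm of \<open>f\<close> at radius \<open>\<gamma>\<close> is \<open>s\<close>. Everything is deduced from this one inequality.

  Existence. Comparing coefficients in \<open>g \<circ> f = \<lambda> g\<close> determines \<open>g\<close> recursively:
  \<open>(\<lambda> - \<lambda>\<^sup>n) g\<^sub>n\<close> is the sum over \<open>k < n\<close> of \<open>g\<^sub>k\<close> times the coefficient of \<open>x\<^sup>n\<close> in \<open>f\<^sup>k\<close>. Since
  \<open>\<bar>\<lambda>\<bar> > 1\<close>, the ultrametric inequality gives \<open>\<bar>\<lambda> - \<lambda>\<^sup>n\<bar> = \<bar>\<lambda>\<bar>\<^sup>n\<close> exactly, so there are no small
  divisors. Gauss norms are submultiplicative, hence \<open>f\<^sup>k\<close> has norm at most \<open>s\<^sup>k\<close> at radius \<open>\<gamma>\<close>, and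
  by induction \<open>g\<close> has norm at most \<open>s\<close> at radius \<open>s\<close> (\<open>koenigs_series_gauss_bound\<close>). The same
  induction applied to \<open>g\<^sup>-\<^sup>1 \<circ> g = x\<close> gives the same bound for \<open>g\<^sup>-\<^sup>1\<close> (\<open>fps_inv_gauss_bound\<close>).

  A series whose Gauss norm at radius \<open>r\<close> is attained by the linear term \<open>c x\<close> multiplies distances
  by exactly \<open>\<bar>c\<bar>\<close> on the open disc of radius \<open>r\<close> (\<open>absval_value_diff\<close>). Thus \<open>g\<close> and \<open>g\<^sup>-\<^sup>1\<close>
  are isometric on the disc of radius \<open>s\<close>, so that \<open>g\<close> is injective there, and \<open>f\<close> maps the disc of
  radius \<open>\<gamma>\<close> into that of radius \<open>s\<close>. The two formal identities turn into the conjugacies because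
  the value of a composite series is the composite of the values (\<open>value_at_compose\<close>).

  Uniqueness. If \<open>d\<close> is the difference of two solutions and \<open>m \<ge> 2\<close> is its order, then
  \<open>\<bar>d(x)\<bar> = \<bar>d\<^sub>m\<bar> * \<bar>x\<bar>\<^sup>m\<close> for all small nonzero \<open>x\<close>. As \<open>\<bar>f(x)\<bar> = \<bar>\<lambda>\<bar> * \<bar>x\<bar>\<close>, the equation
  \<open>d(f(x)) = \<lambda> d(x)\<close> forces \<open>\<bar>\<lambda>\<bar>\<^sup>m = \<bar>\<lambda>\<bar>\<close>, which is impossible (\<open>eigenfunction_eq_zero\<close>).
  This needs the equation only near \<open>0\<close>, so it is enough that \<open>\<delta>\<^sub>f > 0\<close>; the existence part, in turn,
  gives the conjugacies for \<open>\<bar>x\<bar> < \<gamma>\<close>, and \<open>\<delta>\<^sub>f \<le> \<gamma>\<close>.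
\<close>

section \<open>Ultrametric inequalities\<close>

lemma absval_zero [simp]: "absval (0::'a::ultrametric_field) = 0"
  by (simp add: absval_eq_0_iff)

lemma absval_one [simp]: "absval (1::'a::ultrametric_field) = 1"
  using absval_mult[of "1::'a" 1] absval_eq_0_iff[of "1::'a"] by simp

lemma absval_pos: "x \<noteq> 0 \<Longrightarrow> 0 < absval (x::'a::ultrametric_field)"
  using absval_nonneg[of x] absval_eq_0_iff[of x] by linarith

lemma absval_minus [simp]: "absval (- x) = absval (x::'a::ultrametric_field)"
  by (metis diff_0 dist_absval dist_commute diff_zero)

lemma absval_minus_commute: "absval (x - y) = absval (y - x :: 'a::ultrametric_field)"
  by (metis dist_absval dist_commute)

lemma absval_add_le:
  "absval x \<le> B \<Longrightarrow> absval y \<le> B \<Longrightarrow> absval (x + y :: 'a::ultrametric_field) \<le> B"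
  using absval_add[of x y] by linarith

lemma absval_diff: "absval (x - y) \<le> max (absval x) (absval (y::'a::ultrametric_field))"
  using absval_add[of x "- y"] by simp

lemma absval_power: "absval (x ^ n) = absval (x::'a::ultrametric_field) ^ n"
  by (induction n) (simp_all add: absval_mult)

lemma absval_inverse: "absval (inverse x) = inverse (absval (x::'a::ultrametric_field))"
  by (metis absval_eq_0_iff absval_mult absval_one inverse_unique inverse_zero right_inverse)

lemma absval_sum_le:
  fixes u :: "'b \<Rightarrow> 'a::ultrametric_field"
  assumes "0 \<le> B" and "\<And>i. i \<in> I \<Longrightarrow> absval (u i) \<le> B"
  shows "absval (sum u I) \<le> B"
  using assms(2)
proof (induction I rule: infinite_finite_induct)
  case (insert i I)
  then show ?case using absval_add[of "u i" "sum u I"] by fastforce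
qed (use assms(1) in auto)

text \<open>Every triangle is isosceles: a strictly smaller perturbation does not change the size.\<close>

lemma absval_eq_dominant:
  fixes x y :: "'a::ultrametric_field"
  assumes "absval (x - y) < absval y"
  shows "absval x = absval y"
  using assms absval_add[of "x - y" y] absval_diff[of x "x - y"] by simp

lemma tendsto_iff_absval:
  fixes X :: "nat \<Rightarrow> 'a::ultrametric_field"
  shows "X \<longlonglongrightarrow> l \<longleftrightarrow> (\<lambda>n. absval (X n - l)) \<longlonglongrightarrow> 0"
  using tendsto_dist_iff[of X l sequentially] by (simp add: dist_absval)

lemma absval_limit_le:
  fixes X :: "nat \<Rightarrow> 'a::ultrametric_field"
  assumes "X \<longlonglongrightarrow> l" and "\<And>n. N \<le> n \<Longrightarrow> absval (X n - c) \<le> B"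
  shows "absval (l - c) \<le> B"
proof -
  have "(\<lambda>n. dist (X n) c) \<longlonglongrightarrow> dist l c"
    by (intro tendsto_intros assms(1))
  then show ?thesis
    using assms(2) by (intro LIMSEQ_le_const2[of _ "absval (l - c)"]) (auto simp: dist_absval)
qed

text \<open>
  The formulas for the values of products and of compositions are proved in this way, by bounding the
  error of each partial sum; only finite double sums then have to be rearranged.
\<close>

lemma sums_if_geometric_error:
  fixes u :: "nat \<Rightarrow> 'a::ultrametric_field"
  assumes "0 \<le> q" "q < 1" and "\<And>N. absval (S - (\<Sum>n<N. u n)) \<le> C * q ^ N"
  shows "u sums S"
proof -
  have "(\<lambda>N. C * q ^ N) \<longlonglongrightarrow> 0"
    using LIMSEQ_realpow_zero[OF assms(1,2)] by (rule tendsto_mult_right_zero)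
  then have "(\<lambda>N. absval ((\<Sum>n<N. u n) - S)) \<longlonglongrightarrow> 0"
    by (rule tendsto_sandwich[OF _ _ tendsto_const, rotated 2])
      (use assms(3) in \<open>auto simp: absval_nonneg absval_minus_commute[of _ S]\<close>)
  then show ?thesis
    by (simp add: sums_def tendsto_iff_absval)
qed

lemma sums_diff_ultrametric:
  fixes u v :: "nat \<Rightarrow> 'a::ultrametric_field"
  assumes "u sums a" "v sums b"
  shows "(\<lambda>n. u n - v n) sums (a - b)"
proof -
  have "(\<lambda>N. absval ((\<Sum>n<N. u n) - a) + absval ((\<Sum>n<N. v n) - b)) \<longlonglongrightarrow> 0 + 0"
    using assms unfolding sums_def tendsto_iff_absval by (rule tendsto_add)
  then have lim: "(\<lambda>N. absval ((\<Sum>n<N. u n) - a) + absval ((\<Sum>n<N. v n) - b)) \<longlonglongrightarrow> 0"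
    by simp
  have "absval ((\<Sum>n<N. u n - v n) - (a - b))
      \<le> absval ((\<Sum>n<N. u n) - a) + absval ((\<Sum>n<N. v n) - b)" for N
  proof -
    have eq: "(\<Sum>n<N. u n - v n) - (a - b) = ((\<Sum>n<N. u n) - a) - ((\<Sum>n<N. v n) - b)"
      by (simp add: sum_subtractf)
    show ?thesis
      unfolding eq
      using absval_diff[of "(\<Sum>n<N. u n) - a" "(\<Sum>n<N. v n) - b"]
        absval_nonneg[of "(\<Sum>n<N. u n) - a"] absval_nonneg[of "(\<Sum>n<N. v n) - b"]
      by linarith
  qed
  then have "(\<lambda>N. absval ((\<Sum>n<N. u n - v n) - (a - b))) \<longlonglongrightarrow> 0"
    by (intro tendsto_sandwich[OF _ _ tendsto_const lim]) (auto simp: absval_nonneg)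
  then show ?thesis
    by (simp add: sums_def tendsto_iff_absval)
qed

lemma value_at_sums: "converges_at a x \<Longrightarrow> (\<lambda>n. fps_nth a n * x ^ n) sums value_at a x"
  unfolding converges_at_def value_at_def by (rule summable_sums)

lemma value_atI:
  "(\<lambda>n. fps_nth a n * x ^ n) sums S \<Longrightarrow> converges_at a x \<and> value_at a x = S"
  unfolding converges_at_def value_at_def by (auto simp: sums_iff)

lemma value_at_diff:
  assumes "converges_at a x" "converges_at b x"
  shows "converges_at (a - b) x" "value_at (a - b) x = value_at a x - value_at b x"
  using value_atI[of "a - b" x] sums_diff_ultrametric[OF assms[THEN value_at_sums]]
  by (auto simp: left_diff_distrib)


section \<open>Gauss norms\<close>

text \<open>
  The Gauss norm of a series at radius \<open>r\<close> is the supremum of \<open>\<bar>a\<^sub>n\<bar> * r\<^sup>n\<close>. Working with upper bounds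
  \<open>C\<close> for it keeps all quantities real when the supremum is infinite.
\<close>

definition gauss_bound :: "real \<Rightarrow> real \<Rightarrow> 'a::ultrametric_field fps \<Rightarrow> bool" where
  "gauss_bound r C a \<longleftrightarrow> (\<forall>n. absval (fps_nth a n) * r ^ n \<le> C)"

lemma gauss_bound_nonneg: "gauss_bound r C a \<Longrightarrow> 0 \<le> C"
  using absval_nonneg[of "fps_nth a 0"] unfolding gauss_bound_def
  by (elim allE[of _ 0]) simp

lemma gauss_bound_mult:
  assumes "gauss_bound r A a" "gauss_bound r B b" "0 < r"
  shows "gauss_bound r (A * B) (a * b)"
  unfolding gauss_bound_def
proof
  fix n
  have "A \<ge> 0" "B \<ge> 0" using assms by (auto dest: gauss_bound_nonneg)
  have "absval (\<Sum>i=0..n. fps_nth a i * fps_nth b (n - i)) \<le> A * B / r ^ n"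
  proof (rule absval_sum_le)
    fix i assume i: "i \<in> {0..n}"
    have "(absval (fps_nth a i) * r ^ i) * (absval (fps_nth b (n - i)) * r ^ (n - i)) \<le> A * B"
      by (rule mult_mono)
        (use assms \<open>A \<ge> 0\<close> in \<open>auto simp: gauss_bound_def absval_nonneg\<close>)
    moreover have "r ^ n = r ^ i * r ^ (n - i)" using i by (simp flip: power_add)
    ultimately have "absval (fps_nth a i * fps_nth b (n - i)) * r ^ n \<le> A * B"
      by (simp add: absval_mult mult_ac)
    then show "absval (fps_nth a i * fps_nth b (n - i)) \<le> A * B / r ^ n"
      using assms(3) by (simp add: pos_le_divide_eq)
  qed (use assms(3) \<open>A \<ge> 0\<close> \<open>B \<ge> 0\<close> in auto)
  then show "absval (fps_nth (a * b) n) * r ^ n \<le> A * B"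
    using assms(3) by (simp add: pos_le_divide_eq fps_mult_nth)
qed

lemma gauss_bound_power:
  assumes "gauss_bound r A a" "0 < r"
  shows "gauss_bound r (A ^ k) (a ^ k)"
proof (induction k)
  case 0
  then show ?case by (auto simp: gauss_bound_def fps_one_nth)
next
  case (Suc k)
  then show ?case using gauss_bound_mult[OF assms(1) Suc.IH assms(2)] by simp
qed

lemma gauss_bound_term:
  assumes "gauss_bound r C a" "absval x < r"
  shows "absval (fps_nth a n * x ^ n) \<le> C * (absval x / r) ^ n"
proof -
  have r: "r > 0" using assms(2) absval_nonneg[of x] by linarith
  then have "absval (fps_nth a n) \<le> C / r ^ n"
    using assms(1) by (simp add: gauss_bound_def pos_le_divide_eq)
  then have "absval (fps_nth a n) * absval x ^ n \<le> C / r ^ n * absval x ^ n"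
    by (rule mult_right_mono) (simp add: absval_nonneg)
  then show ?thesis by (simp add: absval_mult absval_power power_divide)
qed

lemma ratio_bounds:
  fixes x :: "'a::ultrametric_field"
  assumes "absval x < r" shows "0 \<le> absval x / r" "absval x / r < 1" "0 < r"
  using assms absval_nonneg[of x] by (auto simp: field_simps)

lemma gauss_bound_segment:
  assumes "gauss_bound r C a" "absval x < r" "\<And>n. n \<in> I \<Longrightarrow> N \<le> n"
  shows "absval (\<Sum>n\<in>I. fps_nth a n * x ^ n) \<le> C * (absval x / r) ^ N"
proof (rule absval_sum_le)
  fix n assume "n \<in> I"
  then have "(absval x / r) ^ n \<le> (absval x / r) ^ N"
    using ratio_bounds[OF assms(2)] assms(3) by (intro power_decreasing) auto
  then have "C * (absval x / r) ^ n \<le> C * (absval x / r) ^ N"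
    using gauss_bound_nonneg[OF assms(1)] by (rule mult_left_mono)
  with gauss_bound_term[OF assms(1,2), of n]
  show "absval (fps_nth a n * x ^ n) \<le> C * (absval x / r) ^ N" by linarith
qed (use gauss_bound_nonneg[OF assms(1)] ratio_bounds[OF assms(2)] in auto)

lemma gauss_bound_converges:
  fixes a :: "'a::complete_ultrametric_field fps"
  assumes "gauss_bound r C a" "absval x < r"
  shows "converges_at a x"
proof -
  define q where "q = absval x / r"
  define S where "S = (\<lambda>N. \<Sum>n<N. fps_nth a n * x ^ n)"
  note q = ratio_bounds[OF assms(2), folded q_def]
  have step: "dist (S m) (S n) \<le> C * q ^ n" if "n \<le> m" for m n
  proof -
    have "S m - S n = (\<Sum>n=n..<m. fps_nth a n * x ^ n)"
      using that unfolding S_def lessThan_atLeast0 by (rule sum_diff_nat_ivl[OF le0])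
    then show ?thesis
      using gauss_bound_segment[OF assms, of "{n..<m}" n] by (simp add: dist_absval q_def)
  qed
  have "Cauchy S"
  proof (rule metric_CauchyI)
    fix e :: real assume "0 < e"
    have "(\<lambda>N. C * q ^ N) \<longlonglongrightarrow> 0"
      using LIMSEQ_realpow_zero[OF q(1,2)] by (rule tendsto_mult_right_zero)
    then have "\<forall>\<^sub>F N in sequentially. C * q ^ N < e"
      using \<open>0 < e\<close> by (rule order_tendstoD)
    then obtain M where M: "C * q ^ N < e" if "N \<ge> M" for N
      by (auto simp: eventually_sequentially)
    have "dist (S m) (S n) < e" if "m \<ge> M" "n \<ge> M" for m n
      using step[of m n] step[of n m] M[OF that(1)] M[OF that(2)]
      by (cases "n \<le> m") (auto simp: dist_commute)
    then show "\<exists>M. \<forall>m\<ge>M. \<forall>n\<ge>M. dist (S m) (S n) < e" by blast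
  qed
  then have "convergent S" by (rule Cauchy_convergent)
  then show ?thesis
    by (simp add: converges_at_def summable_iff_convergent S_def)
qed

text \<open>
  The tail is bounded by its first term, since the bounds on the terms decrease geometrically and the
  ultrametric inequality replaces their sum by their maximum.
\<close>

lemma gauss_bound_tail:
  fixes a :: "'a::complete_ultrametric_field fps"
  assumes "gauss_bound r C a" "absval x < r"
  shows "absval (value_at a x - (\<Sum>n<N. fps_nth a n * x ^ n)) \<le> C * (absval x / r) ^ N"
proof (rule absval_limit_le)
  show "(\<lambda>M. \<Sum>n<M. fps_nth a n * x ^ n) \<longlonglongrightarrow> value_at a x"
    using value_at_sums[OF gauss_bound_converges[OF assms]] by (simp add: sums_def)
  fix M assume "N \<le> M"
  then have "(\<Sum>n<M. fps_nth a n * x ^ n) - (\<Sum>n<N. fps_nth a n * x ^ n) = (\<Sum>n=N..<M. fps_nth a n * x ^ n)"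
    unfolding lessThan_atLeast0 by (rule sum_diff_nat_ivl[OF le0])
  then show "absval ((\<Sum>n<M. fps_nth a n * x ^ n) - (\<Sum>n<N. fps_nth a n * x ^ n)) \<le> C * (absval x / r) ^ N"
    using gauss_bound_segment[OF assms, of "{N..<M}" N] by simp
qed

lemma gauss_bound_value:
  fixes a :: "'a::complete_ultrametric_field fps"
  assumes "gauss_bound r C a" "absval x < r"
  shows "absval (value_at a x) \<le> C"
  using gauss_bound_tail[OF assms, of 0] by simp

text \<open>
  This is the Schwarz lemma; for \<open>C > 0\<close> it shows that \<open>a\<close> maps the open disc of radius \<open>r\<close> into that of
  radius \<open>C\<close>.
\<close>

lemma gauss_bound_value_vanishing:
  fixes a :: "'a::complete_ultrametric_field fps"
  assumes "gauss_bound r C a" "absval x < r" "fps_nth a 0 = 0"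
  shows "absval (value_at a x) \<le> C * (absval x / r)"
  using gauss_bound_tail[OF assms(1,2), of 1] assms(3) by simp

section \<open>Values of products and compositions\<close>

text \<open>
  The product of the values differs from the \<open>N\<close>-th partial sum of the Cauchy product only in terms
  of total degree at least \<open>N\<close>, each of which is at most \<open>A * B * q\<^sup>N\<close>.
\<close>

lemma value_at_mult:
  fixes a b :: "'a::complete_ultrametric_field fps"
  assumes a: "gauss_bound r A a" and b: "gauss_bound r B b" and x: "absval x < r"
  shows "value_at (a * b) x = value_at a x * value_at b x"
proof -
  define q where "q = absval x / r"
  define u where "u = (\<lambda>n. fps_nth a n * x ^ n)"
  define v where "v = (\<lambda>n. fps_nth b n * x ^ n)"
  note q = ratio_bounds[OF x, folded q_def]
  have A: "A \<ge> 0" "B \<ge> 0" using a b by (auto dest: gauss_bound_nonneg)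
  have "absval (value_at a x * value_at b x - (\<Sum>n<N. fps_nth (a * b) n * x ^ n)) \<le> A * B * q ^ N"
    for N
  proof -
    have "(\<Sum>n<N. fps_nth (a * b) n * x ^ n) = (\<Sum>n<N. \<Sum>i\<le>n. u i * v (n - i))"
    proof (rule sum.cong[OF refl])
      fix n
      show "fps_nth (a * b) n * x ^ n = (\<Sum>i\<le>n. u i * v (n - i))"
        unfolding fps_mult_nth sum_distrib_right u_def v_def atLeast0AtMost
        by (intro sum.cong refl)
          (simp add: mult.assoc mult.left_commute[of _ "fps_nth b _"] flip: power_add)
    qed
    also have "\<dots> = (\<Sum>(i,j)\<in>{(i,j). i + j < N}. u i * v j)"
      by (rule sum.triangle_reindex[symmetric])
    also have "{(i,j). i + j < N} = (SIGMA i:{..<N}. {..<N - i})" by auto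
    also have "(\<Sum>(i,j)\<in>(SIGMA i:{..<N}. {..<N - i}). u i * v j) = (\<Sum>i<N. u i * (\<Sum>j<N - i. v j))"
      by (simp add: sum.Sigma[symmetric] sum_distrib_left)
    finally have "value_at a x * value_at b x - (\<Sum>n<N. fps_nth (a * b) n * x ^ n)
      = (value_at a x - (\<Sum>i<N. u i)) * value_at b x + (\<Sum>i<N. u i * (value_at b x - (\<Sum>j<N - i. v j)))"
      by (simp add: algebra_simps sum_subtractf sum_distrib_left)
    moreover have "absval ((value_at a x - (\<Sum>i<N. u i)) * value_at b x) \<le> A * B * q ^ N"
    proof -
      have "absval (value_at a x - (\<Sum>i<N. u i)) * absval (value_at b x) \<le> (A * q ^ N) * B"
        using gauss_bound_tail[OF a x] gauss_bound_value[OF b x] A q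
        by (intro mult_mono) (auto simp: absval_nonneg q_def u_def)
      then show ?thesis by (simp add: absval_mult mult_ac)
    qed
    moreover have "absval (\<Sum>i<N. u i * (value_at b x - (\<Sum>j<N - i. v j))) \<le> A * B * q ^ N"
    proof (rule absval_sum_le)
      fix i assume i: "i \<in> {..<N}"
      have "absval (u i) * absval (value_at b x - (\<Sum>j<N - i. v j)) \<le> (A * q ^ i) * (B * q ^ (N - i))"
        using gauss_bound_term[OF a x] gauss_bound_tail[OF b x] A q
        by (intro mult_mono) (auto simp: absval_nonneg q_def u_def v_def)
      also have "\<dots> = A * B * (q ^ i * q ^ (N - i))" by (simp add: mult_ac)
      also have "q ^ i * q ^ (N - i) = q ^ N" using i by (simp flip: power_add)
      finally show "absval (u i * (value_at b x - (\<Sum>j<N - i. v j))) \<le> A * B * q ^ N"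
        by (simp add: absval_mult)
    qed (use A q in auto)
    ultimately show ?thesis
      by (simp only: absval_add_le)
  qed
  then show ?thesis
    using value_atI[OF sums_if_geometric_error[OF q(1,2)]] by blast
qed

lemma value_at_const: "value_at (fps_const c) x = (c::'a::ultrametric_field)"
proof -
  have "(\<lambda>n. fps_nth (fps_const c) n * x ^ n) = (\<lambda>n. if n = 0 then c else 0)"
    by auto
  then have "(\<lambda>n. fps_nth (fps_const c) n * x ^ n) sums c"
    using sums_single[of 0 "\<lambda>_. c"] by simp
  then show ?thesis using value_atI by blast
qed

lemma value_at_X: "value_at fps_X x = (x::'a::ultrametric_field)"
proof -
  have "(\<lambda>n. fps_nth fps_X n * x ^ n) = (\<lambda>n. if n = 1 then x else 0)"
    by (auto simp: fps_X_def)
  then have "(\<lambda>n. fps_nth fps_X n * x ^ n) sums x"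
    using sums_single[of 1 "\<lambda>_. x"] by simp
  then show ?thesis using value_atI by blast
qed

lemma value_at_power:
  fixes a :: "'a::complete_ultrametric_field fps"
  assumes "gauss_bound r A a" "absval x < r"
  shows "value_at (a ^ k) x = value_at a x ^ k"
proof (induction k)
  case (Suc k)
  have "r > 0" using ratio_bounds[OF assms(2)] by simp
  then show ?case
    using value_at_mult[OF assms(1) gauss_bound_power[OF assms(1)] assms(2), of k] Suc by simp
qed (simp add: value_at_const flip: fps_const_1_eq_1)

text \<open>
  The inner series maps the disc of radius \<open>r\<close> into the disc of radius \<open>s\<close>, where the outer one
  converges. Because \<open>f\<close> has no constant term, \<open>f\<^sup>k\<close> contributes nothing below degree \<open>k\<close>, so the
  \<open>N\<close>-th partial sum of the composite is obtained from that of \<open>g\<close> by truncating each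
  \<open>f(x)\<^sup>k\<close>. Both truncations cost at most \<open>C * q\<^sup>N\<close>: the first because \<open>\<bar>f(x)\<bar> \<le> s * q\<close>, the second
  because \<open>f\<^sup>k\<close> has Gauss norm at most \<open>s\<^sup>k\<close>.
\<close>

lemma value_at_compose:
  fixes f g :: "'a::complete_ultrametric_field fps"
  assumes f: "gauss_bound r s f" "fps_nth f 0 = 0" and g: "gauss_bound s C g" and "0 < s"
    and x: "absval x < r"
  shows "value_at (g oo f) x = value_at g (value_at f x)"
proof -
  define q where "q = absval x / r"
  define z where "z = value_at f x"
  note q = ratio_bounds[OF x, folded q_def]
  have C: "C \<ge> 0" using g by (rule gauss_bound_nonneg)
  have zs: "absval z \<le> s * q"
    using gauss_bound_value_vanishing[OF f(1) x f(2)] by (simp add: z_def q_def)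
  also have "s * q < s" using q \<open>0 < s\<close> by simp
  finally have z: "absval z < s" .
  have "absval (value_at g z - (\<Sum>n<N. fps_nth (g oo f) n * x ^ n)) \<le> C * q ^ N" for N
  proof -
    have "(\<Sum>n<N. fps_nth (g oo f) n * x ^ n) = (\<Sum>n<N. \<Sum>k<N. fps_nth g k * fps_nth (f ^ k) n * x ^ n)"
    proof (rule sum.cong[OF refl])
      fix n assume "n \<in> {..<N}"
      then show "fps_nth (g oo f) n * x ^ n = (\<Sum>k<N. fps_nth g k * fps_nth (f ^ k) n * x ^ n)"
        unfolding fps_compose_nth sum_distrib_right
        by (intro sum.mono_neutral_left) (auto simp: startsby_zero_power_prefix[OF f(2)])
    qed
    also have "\<dots> = (\<Sum>k<N. fps_nth g k * (\<Sum>n<N. fps_nth (f ^ k) n * x ^ n))"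
      by (subst sum.swap) (simp add: sum_distrib_left mult.assoc)
    finally have "value_at g z - (\<Sum>n<N. fps_nth (g oo f) n * x ^ n)
      = (value_at g z - (\<Sum>k<N. fps_nth g k * z ^ k))
        + (\<Sum>k<N. fps_nth g k * (z ^ k - (\<Sum>n<N. fps_nth (f ^ k) n * x ^ n)))"
      by (simp add: right_diff_distrib sum_subtractf)
    moreover have "absval (value_at g z - (\<Sum>k<N. fps_nth g k * z ^ k)) \<le> C * q ^ N"
    proof -
      have "absval z / s \<le> q" using zs \<open>0 < s\<close> by (simp add: field_simps)
      then have "C * (absval z / s) ^ N \<le> C * q ^ N"
        using C \<open>0 < s\<close> by (intro mult_left_mono power_mono) (auto simp: absval_nonneg)
      then show ?thesis using gauss_bound_tail[OF g z, of N] by linarith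
    qed
    moreover have "absval (\<Sum>k<N. fps_nth g k * (z ^ k - (\<Sum>n<N. fps_nth (f ^ k) n * x ^ n))) \<le> C * q ^ N"
    proof (rule absval_sum_le)
      fix k
      have "absval (z ^ k - (\<Sum>n<N. fps_nth (f ^ k) n * x ^ n)) \<le> s ^ k * q ^ N"
        using gauss_bound_tail[OF gauss_bound_power[OF f(1)] x, of k N] q
        by (simp add: value_at_power[OF f(1) x] z_def q_def)
      then have "absval (fps_nth g k) * absval (z ^ k - (\<Sum>n<N. fps_nth (f ^ k) n * x ^ n))
          \<le> absval (fps_nth g k) * (s ^ k * q ^ N)"
        by (intro mult_left_mono absval_nonneg)
      also have "\<dots> = (absval (fps_nth g k) * s ^ k) * q ^ N" by simp
      also have "\<dots> \<le> C * q ^ N"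
        using g q by (intro mult_right_mono) (auto simp: gauss_bound_def)
      finally show "absval (fps_nth g k * (z ^ k - (\<Sum>n<N. fps_nth (f ^ k) n * x ^ n))) \<le> C * q ^ N"
        by (simp add: absval_mult)
    qed (use C q in auto)
    ultimately show ?thesis
      by (simp only: absval_add_le)
  qed
  then show ?thesis
    using value_atI[OF sums_if_geometric_error[OF q(1,2)]] unfolding z_def by blast
qed

section \<open>Series dominated by their linear term\<close>

text \<open>
  For \<open>n \<ge> 2\<close> the factorization of \<open>x\<^sup>n - y\<^sup>n\<close> bounds the contribution of degree \<open>n\<close> to the difference
  by \<open>q\<^sup>n\<^sup>-\<^sup>1 * \<bar>h\<^sub>1\<bar> * \<bar>x - y\<bar>\<close>, where \<open>q < 1\<close> is the larger of \<open>\<bar>x\<bar>\<close> and \<open>\<bar>y\<bar>\<close> divided by \<open>r\<close>. The linear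
  term is therefore strictly dominant.
\<close>

lemma absval_value_diff:
  fixes h :: "'a::complete_ultrametric_field fps"
  assumes h: "gauss_bound r (absval (fps_nth h 1) * r) h" and h1: "fps_nth h 1 \<noteq> 0"
    and x: "absval x < r" and y: "absval y < r"
  shows "absval (value_at h x - value_at h y) = absval (fps_nth h 1) * absval (x - y)"
proof (cases "x = y")
  case False
  define M where "M = max (absval x) (absval y)"
  define q where "q = M / r"
  have r: "0 < r" using ratio_bounds[OF x] by simp
  have q: "0 \<le> q" "q < 1" "M = q * r" "0 \<le> M"
    using r x y absval_nonneg[of x] by (auto simp: q_def M_def field_simps)
  have L: "absval (fps_nth h 1) > 0" using h1 by (rule absval_pos)
  have D: "absval (x - y) > 0" using False by (intro absval_pos) simp
  define t where "t = (\<lambda>n. fps_nth h n * x ^ n - fps_nth h n * y ^ n)"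
  have t: "absval (t n) \<le> q * absval (fps_nth h 1) * absval (x - y)" if "n \<noteq> 1" for n
  proof (cases "n = 0")
    case True
    then show ?thesis using L D q by (simp add: t_def)
  next
    case False
    then obtain k where k: "n = Suc (Suc k)" using \<open>n \<noteq> 1\<close> by (metis One_nat_def not0_implies_Suc)
    have "absval (\<Sum>i<n. y ^ (n - Suc i) * x ^ i) \<le> M ^ Suc k"
    proof (rule absval_sum_le)
      fix i assume i: "i \<in> {..<n}"
      have "absval y ^ (n - Suc i) * absval x ^ i \<le> M ^ (n - Suc i) * M ^ i"
        using q(4) by (intro mult_mono power_mono) (auto simp: M_def absval_nonneg)
      also have "\<dots> = M ^ Suc k" using i k by (simp flip: power_add power_Suc)
      finally show "absval (y ^ (n - Suc i) * x ^ i) \<le> M ^ Suc k"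
        by (simp add: absval_mult absval_power)
    qed (use q in auto)
    moreover have "t n = fps_nth h n * ((x - y) * (\<Sum>i<n. y ^ (n - Suc i) * x ^ i))"
      unfolding t_def by (simp add: right_diff_distrib[symmetric] power_diff_sumr2)
    ultimately have "absval (t n) \<le> absval (fps_nth h n) * (absval (x - y) * M ^ Suc k)"
      by (simp add: absval_mult mult_left_mono absval_nonneg)
    also have "\<dots> = (absval (fps_nth h n) * r ^ n) * (q ^ Suc k * absval (x - y) / r)"
      using r by (simp add: q(3) k power_mult_distrib field_simps)
    also have "\<dots> \<le> (absval (fps_nth h 1) * r) * (q ^ Suc k * absval (x - y) / r)"
      using h q r D by (intro mult_right_mono) (auto simp: gauss_bound_def)
    also have "\<dots> = absval (fps_nth h 1) * absval (x - y) * q ^ Suc k"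
      using r by simp
    also have "\<dots> \<le> absval (fps_nth h 1) * absval (x - y) * q"
      using power_decreasing[of 1 "Suc k" q] q L D by (intro mult_left_mono) auto
    finally show ?thesis by (simp add: mult_ac)
  qed
  have "absval (value_at h x - value_at h y - fps_nth h 1 * (x - y))
      \<le> q * absval (fps_nth h 1) * absval (x - y)"
  proof (rule absval_limit_le)
    show "(\<lambda>N. \<Sum>n<N. t n) \<longlonglongrightarrow> value_at h x - value_at h y"
      using sums_diff_ultrametric[OF value_at_sums value_at_sums,
          OF gauss_bound_converges[OF h x] gauss_bound_converges[OF h y]]
      by (simp add: sums_def t_def)
    fix N :: nat assume "2 \<le> N"
    then have "(\<Sum>n<N. t n) - fps_nth h 1 * (x - y) = (\<Sum>n\<in>{..<N} - {1}. t n)"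
      by (subst sum.remove[of _ 1]) (auto simp: t_def right_diff_distrib)
    then show "absval ((\<Sum>n<N. t n) - fps_nth h 1 * (x - y))
        \<le> q * absval (fps_nth h 1) * absval (x - y)"
      using t q L D by (auto intro!: absval_sum_le)
  qed
  also have "\<dots> < absval (fps_nth h 1 * (x - y))"
    using q L D by (simp add: absval_mult)
  finally have "absval (value_at h x - value_at h y) = absval (fps_nth h 1 * (x - y))"
    by (rule absval_eq_dominant)
  then show ?thesis by (simp add: absval_mult)
qed auto

lemma absval_value:
  fixes h :: "'a::complete_ultrametric_field fps"
  assumes "gauss_bound r (absval (fps_nth h 1) * r) h" "fps_nth h 0 = 0" "fps_nth h 1 \<noteq> 0"
    and "absval x < r"
  shows "absval (value_at h x) = absval (fps_nth h 1) * absval x"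
proof -
  have "value_at h 0 = 0"
    using gauss_bound_value_vanishing[OF assms(1) _ assms(2), of 0] ratio_bounds[OF assms(4)]
      absval_nonneg[of "value_at h 0"] absval_eq_0_iff[of "value_at h 0"] by simp
  then show ?thesis
    using absval_value_diff[OF assms(1,3,4), of 0] ratio_bounds[OF assms(4)] by simp
qed

section \<open>The linearizing series\<close>

lemma fps_compose_nth_top:
  fixes b f :: "'a::comm_ring_1 fps"
  assumes "fps_nth f 0 = 0"
  shows "fps_nth (b oo f) n = (\<Sum>k<n. fps_nth b k * fps_nth (f ^ k) n) + fps_nth b n * fps_nth f 1 ^ n"
  unfolding fps_compose_nth atLeast0AtMost
  by (subst lessThan_Suc_atMost[symmetric]) (simp add: startsby_zero_power_nth_same[OF assms])

text \<open>
  The common estimate for the linearizing series (\<open>L = \<bar>\<lambda>\<bar>\<close>) and for a compositional inverse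
  (\<open>L = 1\<close>). If \<open>\<bar>b\<^sub>k\<bar> * (L * r)\<^sup>k \<le> C\<close> for \<open>k < n\<close>, then every summand \<open>b\<^sub>k * (f\<^sup>k)\<^sub>n\<close> is at most \<open>C / r\<^sup>n\<close>, as
  \<open>f\<^sup>k\<close> has Gauss norm at most \<open>(L * r)\<^sup>k\<close> at radius \<open>r\<close>; the factor \<open>L\<^sup>n\<close> on the left of the recursion
  is what moves the bound from radius \<open>r\<close> to radius \<open>L * r\<close>.
\<close>

lemma gauss_bound_recursive:
  fixes b f :: "'a::ultrametric_field fps"
  assumes f: "gauss_bound r (L * r) f" and "0 < r" "0 < L"
    and b: "fps_nth b 0 = 0" "absval (fps_nth b 1) * (L * r) \<le> C"
    and rec: "\<And>n. 2 \<le> n \<Longrightarrow>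
      absval (fps_nth b n) * L ^ n \<le> absval (\<Sum>k<n. fps_nth b k * fps_nth (f ^ k) n)"
  shows "gauss_bound (L * r) C b"
  unfolding gauss_bound_def
proof
  fix n
  have C: "0 \<le> C"
    using b(2) assms(2,3) absval_nonneg[of "fps_nth b 1"]
    by (meson mult_nonneg_nonneg less_imp_le order_trans)
  show "absval (fps_nth b n) * (L * r) ^ n \<le> C"
  proof (induction n rule: less_induct)
    case (less n)
    consider "n = 0" | "n = 1" | "2 \<le> n" by linarith
    then show ?case
    proof cases
      case 3
      have "absval (\<Sum>k<n. fps_nth b k * fps_nth (f ^ k) n) \<le> C / r ^ n"
      proof (rule absval_sum_le)
        fix k assume "k \<in> {..<n}"
        have "absval (fps_nth b k * fps_nth (f ^ k) n) * r ^ n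
            = absval (fps_nth b k) * (absval (fps_nth (f ^ k) n) * r ^ n)"
          by (simp add: absval_mult)
        also have "\<dots> \<le> absval (fps_nth b k) * (L * r) ^ k"
          using gauss_bound_power[OF f \<open>0 < r\<close>, of k]
          by (intro mult_left_mono absval_nonneg) (simp add: gauss_bound_def)
        also have "\<dots> \<le> C" using less.IH \<open>k \<in> {..<n}\<close> by simp
        finally show "absval (fps_nth b k * fps_nth (f ^ k) n) \<le> C / r ^ n"
          using \<open>0 < r\<close> by (simp add: pos_le_divide_eq)
      qed (use C \<open>0 < r\<close> in auto)
      then have "absval (fps_nth b n) * L ^ n \<le> C / r ^ n"
        using rec[OF 3] by linarith
      then show ?thesis
        using \<open>0 < r\<close> by (simp add: pos_le_divide_eq power_mult_distrib mult.assoc)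
    qed (use b C in auto)
  qed
qed

lemma fps_inv_gauss_bound:
  fixes g :: "'a::ultrametric_field fps"
  assumes "gauss_bound r r g" "0 < r" "fps_nth g 0 = 0" "fps_nth g 1 = 1"
  shows "fps_nth (fps_inv g) 0 = 0" "fps_nth (fps_inv g) 1 = 1" "gauss_bound r r (fps_inv g)"
proof -
  have inv: "fps_inv g oo g = fps_X" by (rule fps_inv) (use assms in auto)
  show 0: "fps_nth (fps_inv g) 0 = 0" by (simp add: fps_inv_def)
  then show 1: "fps_nth (fps_inv g) 1 = 1"
    using fps_compose_nth_top[OF assms(3), of "fps_inv g" 1] assms(4) by (simp add: inv)
  have "gauss_bound (1 * r) r (fps_inv g)"
  proof (rule gauss_bound_recursive)
    fix n :: nat assume "2 \<le> n"
    then have "(\<Sum>k<n. fps_nth (fps_inv g) k * fps_nth (g ^ k) n) = - fps_nth (fps_inv g) n"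
      using fps_compose_nth_top[OF assms(3), of "fps_inv g" n] assms(4)
      by (simp add: inv eq_neg_iff_add_eq_0)
    then show "absval (fps_nth (fps_inv g) n) * 1 ^ n
        \<le> absval (\<Sum>k<n. fps_nth (fps_inv g) k * fps_nth (g ^ k) n)" by simp
  qed (use assms 0 1 in auto)
  then show "gauss_bound r r (fps_inv g)" by simp
qed

text \<open>
  The coefficients of the Koenigs function, read off from the equation \<open>g \<circ> f = \<lambda> g\<close> with
  \<open>\<lambda>\<close> the linear coefficient of \<open>f\<close>.
\<close>

fun koenigs_coeff :: "'a::field fps \<Rightarrow> nat \<Rightarrow> 'a" where
  "koenigs_coeff f n =
    (if n = 0 then 0 else if n = 1 then 1
     else (\<Sum>k<n. koenigs_coeff f k * fps_nth (f ^ k) n) / (fps_nth f 1 - fps_nth f 1 ^ n))"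

declare koenigs_coeff.simps [simp del]

definition koenigs_series :: "'a::field fps \<Rightarrow> 'a fps" where
  "koenigs_series f = Abs_fps (koenigs_coeff f)"

lemma koenigs_series_0 [simp]: "fps_nth (koenigs_series f) 0 = 0"
  by (simp add: koenigs_series_def koenigs_coeff.simps)

lemma koenigs_series_1 [simp]:
  "fps_nth (koenigs_series f) 1 = 1" "fps_nth (koenigs_series f) (Suc 0) = 1"
  by (simp_all add: koenigs_series_def koenigs_coeff.simps)

text \<open>
  The divisors of the recursion are as large as possible, whatever the characteristic of the field and
  of its residue field.
\<close>

lemma absval_multiplier:
  fixes lam :: "'a::ultrametric_field"
  assumes "1 < absval lam" "2 \<le> n"
  shows "absval (lam - lam ^ n) = absval lam ^ n"
proof -
  have "absval ((lam - lam ^ n) - (- (lam ^ n))) < absval (- (lam ^ n))"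
    using power_strict_increasing[of 1 n "absval lam"] assms by (simp add: absval_power)
  then have "absval (lam - lam ^ n) = absval (- (lam ^ n))" by (rule absval_eq_dominant)
  then show ?thesis by (simp add: absval_power)
qed

lemma koenigs_series_rec:
  fixes f :: "'a::ultrametric_field fps"
  assumes "1 < absval (fps_nth f 1)" "2 \<le> n"
  shows "fps_nth (koenigs_series f) n * (fps_nth f 1 - fps_nth f 1 ^ n)
    = (\<Sum>k<n. fps_nth (koenigs_series f) k * fps_nth (f ^ k) n)"
proof -
  have "absval (fps_nth f 1 - fps_nth f 1 ^ n) > 0"
    unfolding absval_multiplier[OF assms] using assms(1) by simp
  then have "fps_nth f 1 - fps_nth f 1 ^ n \<noteq> 0" by auto
  then show ?thesis
    using assms(2) by (simp add: koenigs_series_def koenigs_coeff.simps[of f n])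
qed

lemma koenigs_series_compose:
  fixes f :: "'a::ultrametric_field fps"
  assumes "fps_nth f 0 = 0" "1 < absval (fps_nth f 1)"
  shows "koenigs_series f oo f = fps_const (fps_nth f 1) * koenigs_series f"
proof (rule fps_ext)
  fix n :: nat
  consider "n = 0" | "n = 1" | "2 \<le> n" by linarith
  then show "fps_nth (koenigs_series f oo f) n = fps_nth (fps_const (fps_nth f 1) * koenigs_series f) n"
  proof cases
    case 3
    show ?thesis
      unfolding fps_compose_nth_top[OF assms(1)] koenigs_series_rec[OF assms(2) 3, symmetric]
      by (simp add: algebra_simps)
  qed (simp_all add: fps_compose_nth_top[OF assms(1)])
qed

lemma koenigs_series_gauss_bound:
  fixes f :: "'a::ultrametric_field fps"
  assumes f: "gauss_bound r (absval (fps_nth f 1) * r) f" "0 < r" "1 < absval (fps_nth f 1)"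
  shows "gauss_bound (absval (fps_nth f 1) * r) (absval (fps_nth f 1) * r) (koenigs_series f)"
proof (rule gauss_bound_recursive[OF f(1,2)])
  fix n :: nat assume n: "2 \<le> n"
  show "absval (fps_nth (koenigs_series f) n) * absval (fps_nth f 1) ^ n
    \<le> absval (\<Sum>k<n. fps_nth (koenigs_series f) k * fps_nth (f ^ k) n)"
    unfolding koenigs_series_rec[OF f(3) n, symmetric] absval_mult absval_multiplier[OF f(3) n] by simp
qed (use assms(3) in simp_all)

section \<open>Uniqueness\<close>

text \<open>
  Since \<open>\<bar>\<lambda>\<bar> > 1\<close>, the absolute value is not trivial. Uniqueness depends on this: for a trivial
  absolute value a small disc contains only \<open>0\<close>.
\<close>

lemma exists_small_nonzero:
  fixes lam :: "'a::ultrametric_field"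
  assumes "1 < absval lam" "0 < e"
  shows "\<exists>x::'a. x \<noteq> 0 \<and> absval x < e"
proof -
  have "inverse (absval lam) < 1" using assms(1) by (simp add: field_simps)
  then obtain n where "inverse (absval lam) ^ n < e" 
    using real_arch_pow_inv[OF assms(2), of "inverse (absval lam)"] by blast
  moreover have "lam \<noteq> 0" using assms(1) by auto
  ultimately have "inverse lam ^ n \<noteq> 0 \<and> absval (inverse lam ^ n) < e"
    by (simp add: absval_power absval_inverse)
  then show ?thesis ..
qed

text \<open>
  The terms of a convergent series tend to zero, hence are bounded. This supplies a bound for a
  competing solution, about which only convergence is known.
\<close>

lemma converges_at_gauss_bound:
  assumes "converges_at a x"
  shows "\<exists>C. gauss_bound (absval x) C a"
proof -
  define S where "S = (\<lambda>N. \<Sum>n<N. fps_nth a n * x ^ n)"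
  have S: "S \<longlonglongrightarrow> value_at a x"
    using value_at_sums[OF assms] by (simp add: sums_def S_def)
  have "(\<lambda>n. dist (S (Suc n)) (S n)) \<longlonglongrightarrow> dist (value_at a x) (value_at a x)"
    by (intro tendsto_dist LIMSEQ_Suc S)
  then have "Bseq (\<lambda>n. dist (S (Suc n)) (S n))"
    by (intro convergent_imp_Bseq convergentI)
  moreover have "dist (S (Suc n)) (S n) = absval (fps_nth a n) * absval x ^ n" for n
    by (simp add: S_def dist_absval absval_mult absval_power)
  ultimately have "Bseq (\<lambda>n. absval (fps_nth a n) * absval x ^ n)" by simp
  then obtain C where "\<forall>n. norm (absval (fps_nth a n) * absval x ^ n) \<le> C"
    by (auto dest: BseqD)
  then have "gauss_bound (absval x) C a" by (simp add: gauss_bound_def absval_nonneg abs_mult)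
  then show ?thesis ..
qed

lemma leading_term_dominates:
  fixes d :: "'a::complete_ultrametric_field fps"
  assumes d: "gauss_bound r C d" "0 < r" and dm: "fps_nth d m \<noteq> 0" "\<And>k. k < m \<Longrightarrow> fps_nth d k = 0"
  shows "\<exists>e>0. \<forall>x. x \<noteq> 0 \<longrightarrow> absval x < e \<longrightarrow>
    absval (value_at d x) = absval (fps_nth d m) * absval x ^ m"
proof -
  have c: "absval (fps_nth d m) > 0" using dm(1) by (rule absval_pos)
  have "absval (fps_nth d m) * r ^ m \<le> C" using d(1) by (simp add: gauss_bound_def)
  moreover have "0 < absval (fps_nth d m) * r ^ m" using c d(2) by simp
  ultimately have C: "0 < C" by linarith
  (* below this e the tail bound C * (|x| / r)^(m+1) is less than the term of degree m *)
  define e where "e = min r (absval (fps_nth d m) * r ^ Suc m / C)"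
  have "0 < e" using C c d(2) by (simp add: e_def)
  moreover have "absval (value_at d x) = absval (fps_nth d m) * absval x ^ m"
    if "x \<noteq> 0" "absval x < e" for x
  proof -
    have x: "absval x < r" "C * absval x < absval (fps_nth d m) * r ^ Suc m"
      using that(2) C by (simp_all add: e_def pos_less_divide_eq mult.commute del: power_Suc)
    have x0: "absval x > 0" using that(1) by (rule absval_pos)
    have "(\<Sum>n<Suc m. fps_nth d n * x ^ n) = fps_nth d m * x ^ m" using dm(2) by simp
    then have "absval (value_at d x - fps_nth d m * x ^ m) \<le> C * (absval x / r) ^ Suc m"
      using gauss_bound_tail[OF d(1) x(1), of "Suc m"] by simp
    also have "\<dots> = (C * absval x) * absval x ^ m / r ^ Suc m"
      by (simp add: power_divide)
    also have "\<dots> < (absval (fps_nth d m) * r ^ Suc m) * absval x ^ m / r ^ Suc m"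
      using x(2) x0 d(2) by (intro divide_strict_right_mono mult_strict_right_mono zero_less_power)
    also have "\<dots> = absval (fps_nth d m * x ^ m)"
      using zero_less_power[OF d(2), of "Suc m"] by (simp only: absval_mult absval_power field_simps)
    finally have "absval (value_at d x) = absval (fps_nth d m * x ^ m)"
      by (rule absval_eq_dominant)
    then show ?thesis by (simp add: absval_mult absval_power)
  qed
  ultimately show ?thesis by blast
qed

text \<open>
  Composition with \<open>f\<close> multiplies the size of a term of order \<open>m\<close> by \<open>\<bar>\<lambda>\<bar>\<^sup>m\<close>, so an eigenfunction for
  the eigenvalue \<open>\<lambda>\<close> has order \<open>1\<close>.
\<close>

lemma eigenfunction_eq_zero:
  fixes f d :: "'a::complete_ultrametric_field fps"
  assumes f: "gauss_bound r (absval (fps_nth f 1) * r) f" "fps_nth f 0 = 0" "1 < absval (fps_nth f 1)"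
    and "0 < r" "0 < e"
    and d: "fps_nth d 0 = 0" "fps_nth d 1 = 0"
    and conv: "\<And>x. absval x < e \<Longrightarrow> converges_at d x"
    and eigen: "\<And>x. absval x < e \<Longrightarrow> value_at d (value_at f x) = fps_nth f 1 * value_at d x"
  shows "d = 0"
proof (rule ccontr)
  assume "d \<noteq> 0"
  define m where "m = subdegree d"
  have dm: "fps_nth d m \<noteq> 0"
    unfolding m_def using \<open>d \<noteq> 0\<close> by (rule nth_subdegree_nonzero)
  have below: "fps_nth d k = 0" if "k < m" for k
    using that unfolding m_def by (rule nth_less_subdegree_zero)
  have m: "2 \<le> m"
  proof (rule ccontr)
    assume "\<not> 2 \<le> m"
    then have "m = 0 \<or> m = 1" by linarith
    then show False using dm d by (elim disjE) simp_all
  qed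
  define L where "L = absval (fps_nth f 1)"
  have L: "1 < L" using f(3) by (simp add: L_def)
  obtain x0 :: 'a where x0: "x0 \<noteq> 0" "absval x0 < e"
    using exists_small_nonzero[OF f(3) \<open>0 < e\<close>] by blast
  then obtain C where C: "gauss_bound (absval x0) C d"
    using converges_at_gauss_bound[OF conv] by blast
  have "\<exists>e'>0. \<forall>x. x \<noteq> 0 \<longrightarrow> absval x < e' \<longrightarrow>
      absval (value_at d x) = absval (fps_nth d m) * absval x ^ m"
    by (rule leading_term_dominates[OF C absval_pos[OF x0(1)] dm below])
  then obtain e' where "0 < e'"
    and e': "\<And>x. x \<noteq> 0 \<Longrightarrow> absval x < e' \<Longrightarrow> absval (value_at d x) = absval (fps_nth d m) * absval x ^ m"
    by blast
  have "0 < min (min e r) (e' / L)" using \<open>0 < e\<close> \<open>0 < r\<close> \<open>0 < e'\<close> L by simp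
  (* x is so small that the leading term dominates both at x and at f x, which is larger by L *)
  then obtain x :: 'a where x: "x \<noteq> 0" "absval x < min (min e r) (e' / L)"
    using exists_small_nonzero[OF f(3), of "min (min e r) (e' / L)"] by blast
  have xp: "0 < absval x" using x(1) by (rule absval_pos)
  have f1: "fps_nth f 1 \<noteq> 0" using f(3) by auto
  have xr: "absval x < r" using x(2) by linarith
  have fx: "absval (value_at f x) = L * absval x"
    unfolding L_def using absval_value[OF f(1,2) f1 xr] .
  have small: "L * absval x < e'" using x(2) L by (simp add: pos_less_divide_eq mult.commute)
  have "absval x \<le> L * absval x" using L xp by simp
  then have dx: "absval (value_at d x) = absval (fps_nth d m) * absval x ^ m"
    using small by (intro e' x(1)) linarith
  have "value_at f x \<noteq> 0"
  proof
    assume "value_at f x = 0"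
    then show False using fx L xp by simp
  qed
  then have "absval (value_at d (value_at f x)) = absval (fps_nth d m) * (L * absval x) ^ m"
    using e'[of "value_at f x"] small by (simp only: fx not_False_eq_True simp_thms)
  also have "value_at d (value_at f x) = fps_nth f 1 * value_at d x"
    using x(2) by (intro eigen) simp
  finally have "absval (fps_nth d m) * absval x ^ m * L ^ m = absval (fps_nth d m) * absval x ^ m * L"
    unfolding absval_mult dx power_mult_distrib L_def[symmetric] by (simp only: mult_ac)
  moreover have "absval (fps_nth d m) * absval x ^ m > 0" using absval_pos[OF dm] xp by simp
  ultimately have "L ^ m = L" by (metis less_irrefl mult_left_cancel)
  then show False using power_strict_increasing[of 1 m L] L m by simp
qed

section \<open>The radii\<close>

lemma powr_inverse_le_iff:
  assumes "0 \<le> t" "0 \<le> c" "0 < p"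
  shows "t powr (1 / real p) \<le> c \<longleftrightarrow> t \<le> c ^ p" "c \<le> t powr (1 / real p) \<longleftrightarrow> c ^ p \<le> t"
proof -
  have "(t powr (1 / real p)) ^ p = t"
    using assms by (cases "t = 0") (auto simp: powr_power)
  moreover have "0 \<le> t powr (1 / real p)" by simp
  ultimately show "t powr (1 / real p) \<le> c \<longleftrightarrow> t \<le> c ^ p" "c \<le> t powr (1 / real p) \<longleftrightarrow> c ^ p \<le> t"
    using power_mono_iff assms by metis+
qed

text \<open>
  From \<open>\<bar>a\<^sub>i\<bar> \<le> \<rho>\<^sup>1\<^sup>-\<^sup>i\<close> and \<open>\<bar>\<lambda>\<bar> \<ge> 1\<close> one gets \<open>\<gamma> \<ge> \<rho> > 0\<close> and a finite limit superior in the radius of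
  convergence. Moreover \<open>\<gamma>\<close> is finite because \<open>\<rho>\<close> is: some \<open>a\<^sub>i\<close> with \<open>i \<ge> 2\<close> does not vanish.
  The Gauss bound is the definition of \<open>\<gamma>\<close> with the roots cleared.
\<close>

lemma series_family_radii:
  assumes "f \<in> series_family lam \<rho>" "0 < \<rho>" "1 \<le> absval lam"
  obtains r where "0 < r" "gamma_radius f = ereal r" "gauss_bound r (absval lam * r) f"
    "0 < convergence_radius f"
proof -
  define S where "S = (SUP i\<in>{2..}. ereal (absval (fps_nth f i) powr (1 / (real i - 1))))"
  define u where "u = (\<lambda>i. if fps_nth f i = 0 then \<infinity>
       else ereal ((absval (fps_nth f 1) / absval (fps_nth f i)) powr (1 / (real i - 1))))"
  have f: "fps_nth f 0 = 0" "fps_nth f 1 = lam" "1 / S = ereal \<rho>"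
    using assms(1) by (auto simp: series_family_def S_def)
  have S: "S = ereal (1 / \<rho>)"
    using f(3) assms(2) by (cases S) (auto simp: divide_ereal_def field_simps split: if_splits)
  have pred: "real i - 1 = real (i - 1)" "0 < i - 1" if "2 \<le> i" for i using that by auto
  have coeff: "absval (fps_nth f i) \<le> (1 / \<rho>) ^ (i - 1)" if "2 \<le> i" for i
  proof -
    have "ereal (absval (fps_nth f i) powr (1 / (real i - 1))) \<le> S"
      unfolding S_def using that by (intro SUP_upper) auto
    then show ?thesis
      using powr_inverse_le_iff(1)[OF absval_nonneg _ pred(2)[OF that], of "1 / \<rho>" "fps_nth f i"] assms(2)
      by (simp add: S pred(1)[OF that])
  qed
  have pos: "0 < absval (fps_nth f i)" if "fps_nth f i \<noteq> 0" for i
    using that by (rule absval_pos)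
  have "\<exists>j\<ge>2. fps_nth f j \<noteq> 0"
  proof (rule ccontr)
    assume "\<not> ?thesis"
    then have "S \<le> 0" unfolding S_def by (intro SUP_least) auto
    then show False using S assms(2) by (simp add: zero_ereal_def)
  qed
  then obtain j where j: "2 \<le> j" "fps_nth f j \<noteq> 0" by blast
  have gamma: "gamma_radius f = (INF i\<in>{2..}. u i)" by (simp add: gamma_radius_def u_def)
  have u_iff: "ereal c \<le> u i \<longleftrightarrow> c ^ (i - 1) * absval (fps_nth f i) \<le> absval lam"
    if "2 \<le> i" "fps_nth f i \<noteq> 0" "0 \<le> c" for c i
  proof -
    have "u i = ereal ((absval lam / absval (fps_nth f i)) powr (1 / real (i - 1)))"
      unfolding u_def f(2) pred(1)[OF that(1)] by (simp only: that(2) if_False)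
    moreover have "0 \<le> absval lam / absval (fps_nth f i)"
      by (simp add: absval_nonneg)
    ultimately show ?thesis
      using powr_inverse_le_iff(2)[OF _ that(3) pred(2)[OF that(1)]] pos[OF that(2)]
      by (simp only: ereal_less_eq(3) pos_le_divide_eq)
  qed
  have "ereal \<rho> \<le> gamma_radius f"
    unfolding gamma
  proof (rule INF_greatest)
    fix i :: nat assume i: "i \<in> {2..}"
    show "ereal \<rho> \<le> u i"
    proof (cases "fps_nth f i = 0")
      case False
      have "\<rho> ^ (i - 1) * absval (fps_nth f i) \<le> 1"
        using coeff[of i] i assms(2) by (simp add: power_one_over field_simps)
      then show ?thesis
        using u_iff[of i \<rho>] i False assms(2,3) by simp
    qed (simp add: u_def)
  qed
  moreover have "gamma_radius f \<le> u j" unfolding gamma using j by (intro INF_lower) auto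
  then have "gamma_radius f < \<infinity>" using j by (auto simp: u_def)
  ultimately obtain r where r: "gamma_radius f = ereal r" "\<rho> \<le> r"
    by (cases "gamma_radius f") auto
  have rp: "0 < r" using r(2) assms(2) by linarith
  have "gauss_bound r (absval lam * r) f"
    unfolding gauss_bound_def
  proof
    fix i
    consider "i = 0" | "i = 1" | "2 \<le> i" "fps_nth f i = 0" | "2 \<le> i" "fps_nth f i \<noteq> 0" by linarith
    then show "absval (fps_nth f i) * r ^ i \<le> absval lam * r"
    proof cases
      case 4
      have "ereal r \<le> u i" unfolding r(1)[symmetric] gamma using 4 by (intro INF_lower) auto
      then have "absval (fps_nth f i) * r ^ (i - 1) \<le> absval lam"
        using u_iff[of i r] 4 rp by (simp add: mult.commute)
      then have "absval (fps_nth f i) * r ^ (i - 1) * r \<le> absval lam * r"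
        using rp by (intro mult_right_mono) auto
      moreover have "r ^ i = r ^ (i - 1) * r" using 4(1) by (cases i) auto
      ultimately show ?thesis by (simp add: mult.assoc)
    qed (use f rp assms(3) in auto)
  qed
  moreover have "0 < convergence_radius f"
  proof -
    define Q where "Q = max 1 (1 / \<rho>)"
    have "0 \<le> Q" by (simp add: Q_def)
    define l where "l = limsup (\<lambda>i. ereal (absval (fps_nth f i) powr (1 / real i)))"
    have "l \<le> ereal Q"
      unfolding l_def
    proof (rule Limsup_bounded, rule eventually_sequentiallyI)
      fix i :: nat assume i: "2 \<le> i"
      have "absval (fps_nth f i) \<le> Q ^ (i - 1)"
        using coeff[OF i] power_mono[of "1 / \<rho>" Q "i - 1"] assms(2) by (simp add: Q_def)
      also have "\<dots> \<le> Q ^ i" by (rule power_increasing) (auto simp: Q_def)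
      finally show "ereal (absval (fps_nth f i) powr (1 / real i)) \<le> ereal Q"
        using powr_inverse_le_iff(1)[OF absval_nonneg \<open>0 \<le> Q\<close>, of i "fps_nth f i"] i by simp
    qed
    moreover have "0 \<le> l"
      unfolding l_def by (rule le_Limsup) auto
    ultimately show ?thesis
      by (auto simp: convergence_radius_def l_def[symmetric] divide_ereal_def ereal_0_gt_inverse)
  qed
  ultimately show thesis using that rp r(1) by blast
qed

section \<open>Existence and uniqueness of the linearization\<close>

theorem theorem4p1:
  fixes lam :: "'a::complete_ultrametric_field" and \<rho> :: real and f :: "'a fps"
  assumes "absval lam > 1"
    and "\<rho> > 0"
    and "f \<in> series_family lam \<rho>"
  shows "\<exists>!g :: 'a fps.
    fps_nth g 0 = 0 \<and> fps_nth g 1 = 1 \<and>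
    (\<forall>x \<in> open_disc (ereal (absval lam) * gamma_radius f). converges_at g x) \<and>
    inj_on (value_at g) (open_disc (ereal (absval lam) * gamma_radius f)) \<and>
    semi_conjugacy_on (open_disc (injectivity_radius f)) lam f g \<and>
    full_conjugacy_on (open_disc (injectivity_radius f)) lam f g"
proof -
  obtain r where r: "0 < r" "gamma_radius f = ereal r" and f: "gauss_bound r (absval lam * r) f"
    and R: "0 < convergence_radius f"
    using series_family_radii[OF assms(3,2)] assms(1) by (metis less_imp_le)
  have f0: "fps_nth f 0 = 0" and f1: "fps_nth f 1 = lam"
    using assms(3) by (auto simp: series_family_def)
  note f' = f[folded f1]
  define s where "s = absval lam * r"
  have s: "0 < s" using assms(1) r(1) by (simp add: s_def)
  have big: "x \<in> open_disc (ereal (absval lam) * gamma_radius f) \<longleftrightarrow> absval x < s" for x :: 'a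
    by (simp add: open_disc_def r(2) s_def)
  have small: "absval x < r" if "x \<in> open_disc (injectivity_radius f)" for x :: 'a
    using that by (simp add: open_disc_def injectivity_radius_def r(2))
  have "fps_nth f 1 \<noteq> 0" using assms(1) f1 by auto
  then have fx: "absval (value_at f x) = absval lam * absval x" if "absval x < r" for x
    using absval_value[OF f' f0 _ that] f1 by simp
  have fs: "absval (value_at f x) < s" if "absval x < r" for x
    using fx[OF that] that assms(1) by (simp add: s_def)
  have rs: "absval x < s" if "absval x < r" for x :: 'a
  proof -
    have "r \<le> s" using assms(1) r(1) by (simp add: s_def)
    with that show ?thesis by linarith
  qed
  define g where "g = koenigs_series f"
  have g01: "fps_nth g 0 = 0" "fps_nth g 1 = 1" by (simp_all add: g_def)
  have gb: "gauss_bound s s g"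
    using koenigs_series_gauss_bound[OF f' r(1), unfolded f1] assms(1) by (simp only: s_def g_def)
  note inv = fps_inv_gauss_bound[OF gb s g01]
  have semi: "value_at g (value_at f x) = lam * value_at g x" if x: "absval x < r" for x
  proof -
    have "value_at g (value_at f x) = value_at (g oo f) x"
      using value_at_compose[OF f f0 _ _ x, folded s_def, OF gb s] by simp
    also have "g oo f = fps_const lam * g"
      using koenigs_series_compose[OF f0, unfolded f1] assms(1) by (simp only: g_def)
    also have "value_at (fps_const lam * g) x = lam * value_at g x"
    proof -
      have "gauss_bound s (absval lam) (fps_const lam)"
        by (simp add: gauss_bound_def absval_nonneg)
      from value_at_mult[OF this gb rs[OF x]] show ?thesis by (simp add: value_at_const)
    qed
    finally show ?thesis .
  qed
  have gdiff: "absval (value_at g x - value_at g y) = absval (x - y)" if "absval x < s" "absval y < s" for x y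
    using absval_value_diff[of s g x y] gb g01 that by simp
  have invx: "absval (value_at (fps_inv g) x) = absval x" if "absval x < s" for x
    using absval_value[of s "fps_inv g" x] inv that by simp
  have ginv: "value_at g (value_at (fps_inv g) x) = x" if x: "absval x < s" for x
    using value_at_compose[OF inv(3,1) gb s x] fps_inv_right[of g] g01 by (simp add: value_at_X)
  show ?thesis
  proof (rule ex1I[of _ g], intro conjI)
    show "\<forall>x\<in>open_disc (ereal (absval lam) * gamma_radius f). converges_at g x"
      using gauss_bound_converges[OF gb] big by blast
    show "inj_on (value_at g) (open_disc (ereal (absval lam) * gamma_radius f))"
    proof (rule inj_onI)
      fix x y
      assume "x \<in> open_disc (ereal (absval lam) * gamma_radius f)"
        "y \<in> open_disc (ereal (absval lam) * gamma_radius f)" "value_at g x = value_at g y"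
      then show "x = y" using gdiff[of x y] absval_eq_0_iff[of "x - y"] by (simp add: big)
    qed
    show "semi_conjugacy_on (open_disc (injectivity_radius f)) lam f g"
      unfolding semi_conjugacy_on_def
      using small semi fs rs gauss_bound_converges[OF gb] gauss_bound_converges[OF f] by blast
    show "full_conjugacy_on (open_disc (injectivity_radius f)) lam f g"
      unfolding full_conjugacy_on_def
    proof (rule ballI)
      fix x :: 'a assume "x \<in> open_disc (injectivity_radius f)"
      then have x: "absval x < r" "absval x < s" using small rs by blast+
      then have y: "absval (value_at (fps_inv g) x) < r" using invx by simp
      show "converges_at (fps_inv g) x \<and> converges_at f (value_at (fps_inv g) x) \<and>
        converges_at g (value_at f (value_at (fps_inv g) x)) \<and>
        value_at g (value_at f (value_at (fps_inv g) x)) = lam * x"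
        using gauss_bound_converges[OF inv(3) x(2)] gauss_bound_converges[OF f y]
          gauss_bound_converges[OF gb fs[OF y]] semi[OF y] ginv[OF x(2)] by simp
    qed
  next
    fix h
    assume h: "fps_nth h 0 = 0 \<and> fps_nth h 1 = 1 \<and>
      (\<forall>x \<in> open_disc (ereal (absval lam) * gamma_radius f). converges_at h x) \<and>
      inj_on (value_at h) (open_disc (ereal (absval lam) * gamma_radius f)) \<and>
      semi_conjugacy_on (open_disc (injectivity_radius f)) lam f h \<and>
      full_conjugacy_on (open_disc (injectivity_radius f)) lam f h"
    have "0 < injectivity_radius f" using R r by (simp add: injectivity_radius_def)
    then obtain e where e: "0 < ereal e" "ereal e < injectivity_radius f"
      using ereal_dense2 by blast
    have disc: "x \<in> open_disc (injectivity_radius f)" if "absval x < e" for x :: 'a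
      using that e(2) by (simp add: open_disc_def) (meson ereal_less(2) less_ereal.simps(1) less_trans)
    have hx: "converges_at h x" "converges_at h (value_at f x)"
      "value_at h (value_at f x) = lam * value_at h x" if "absval x < e" for x
      using h disc[OF that] by (auto simp: semi_conjugacy_on_def)
    have gx: "converges_at g x" "converges_at g (value_at f x)" if "absval x < e" for x
      using small[OF disc[OF that]] rs fs gauss_bound_converges[OF gb] by blast+
    have "h - g = 0"
    proof (rule eigenfunction_eq_zero[OF f' f0 _ r(1)])
      show "1 < absval (fps_nth f 1)" using assms(1) f1 by simp
      show "0 < e" using e(1) by simp
      show "fps_nth (h - g) 0 = 0" "fps_nth (h - g) 1 = 0" using h g01 by auto
      fix x :: 'a assume x: "absval x < e"
      show "converges_at (h - g) x" using value_at_diff(1)[OF hx(1) gx(1)] x by blast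
      show "value_at (h - g) (value_at f x) = fps_nth f 1 * value_at (h - g) x"
        using value_at_diff(2)[OF hx(1)[OF x] gx(1)[OF x]] value_at_diff(2)[OF hx(2)[OF x] gx(2)[OF x]]
          hx(3)[OF x] semi[OF small[OF disc[OF x]]] unfolding f1 by (simp add: right_diff_distrib)
    qed
    then show "h = g" by simp
  qed (use g01 in auto)
qed

end
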